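(* Let $n,k,t$ be positive integers with $n\ge k>t$ and let $A\subseteq[0,1]^n$ be an $(n,k,t)$-set. Then the Hausdorff dimension of $A$ is at most $k-t$.
   Context: For positive integers $n\ge k>t$, a subset $A$ of $[0,1]^n$ is an $(n,k,t)$-set if every $(x_1,\ldots,x_n)\in A$ has exactly $k$ strictly positive coordinates, and for every two elements $(x_1,\ldots,x_n),(y_1,\ldots,y_n)\in A$ there exist $t$ distinct indices $i_1,\ldots,i_t\in\{1,\ldots,n\}$ with $x_{i_j}=y_{i_j}>0$ for all $j\in\{1,\ldots,t\}$. *)

theory Defs
  imports "HOL-Analysis.Analysis"
begin

text \<open>
  The summand $\mathrm{diam}(U)^s$ of Hausdorff measure, with the usual conventions
  $\mathrm{diam}(\emptyset)^s = 0$ and $0^0 = 1$ for nonempty \<open>U\<close>. The case distinction is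
  needed because \<open>0 powr 0 = 0\<close> in HOL. Only meaningful for bounded \<open>U\<close>.
\<close>
definition diam_power :: "real \<Rightarrow> 'a::metric_space set \<Rightarrow> ennreal" where
  "diam_power s U =
     (if U = {} then 0 else if s = 0 then 1 else ennreal (diameter U powr s))"

text \<open>
  Boundedness of the covering sets is required explicitly, since \<^const>\<open>diameter\<close> has no
  meaningful value on unbounded sets.
\<close>
definition hausdorff_premeasure ::
  "real \<Rightarrow> real \<Rightarrow> 'a::metric_space set \<Rightarrow> ennreal" where
  "hausdorff_premeasure s \<delta> A =
     (INF U \<in> {U :: nat \<Rightarrow> 'a set.
                 A \<subseteq> (\<Union>i. U i) \<and> (\<forall>i. bounded (U i) \<and> diameter (U i) \<le> \<delta>)}.
        \<Sum>i. diam_power s (U i))"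

definition hausdorff_measure :: "real \<Rightarrow> 'a::metric_space set \<Rightarrow> ennreal" where
  "hausdorff_measure s A = (SUP \<delta> \<in> {0<..}. hausdorff_premeasure s \<delta> A)"

definition hausdorff_dim :: "'a::metric_space set \<Rightarrow> ennreal" where
  "hausdorff_dim A = Inf {ennreal s | s. 0 \<le> s \<and> hausdorff_measure s A = 0}"

text \<open>
  The dimension \<open>n\<close> of the ambient space is \<open>CARD('n)\<close>. The two elements \<open>x\<close>, \<open>y\<close> need not be
  distinct; for \<open>x = y\<close> the condition follows from the first one when \<open>t < k\<close>.
\<close>
definition nkt_set :: "nat \<Rightarrow> nat \<Rightarrow> (real ^ 'n) set \<Rightarrow> bool" where
  "nkt_set k t A \<longleftrightarrow>
     A \<subseteq> {x. \<forall>i. 0 \<le> x $ i \<and> x $ i \<le> 1} \<and>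
     (\<forall>x\<in>A. card {i. x $ i > 0} = k) \<and>
     (\<forall>x\<in>A. \<forall>y\<in>A. \<exists>I. card I = t \<and> (\<forall>i\<in>I. x $ i = y $ i \<and> x $ i > 0))"

end

theory Submission
  imports Defs
begin

text \<open>
  Fix \<open>a \<in> A\<close>. Every \<open>x \<in> A\<close> agrees with \<open>a\<close> on \<open>t\<close> coordinates of its support \<open>J\<close> and vanishes
  outside \<open>J\<close>, so \<open>A\<close> lies in finitely many unit cubes of dimension \<open>k - t\<close>. Cutting these into
  \<open>m ^ (k - t)\<close> cells of side \<open>1 / m\<close> each and letting \<open>m\<close> grow shows that the \<open>s\<close>-dimensional
  Hausdorff measure of \<open>A\<close> vanishes for every \<open>s > k - t\<close>.
\<close>

definition face_cube :: "'n set \<Rightarrow> real ^ 'n \<Rightarrow> (real ^ 'n) set" where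
  "face_cube K c = {x. \<forall>i. if i \<in> K then 0 \<le> x $ i \<and> x $ i \<le> 1 else x $ i = c $ i}"

text \<open>The cells are closed, so neighbours overlap on their boundaries; in return, indices
  below \<open>m\<close> reach the endpoint 1.\<close>

definition face_cell :: "nat \<Rightarrow> 'n set \<Rightarrow> real ^ 'n \<Rightarrow> ('n \<Rightarrow> nat) \<Rightarrow> (real ^ 'n) set" where
  "face_cell m K c g =
     {x. \<forall>i. if i \<in> K then real (g i) / real m \<le> x $ i \<and> x $ i \<le> (real (g i) + 1) / real m
             else x $ i = c $ i}"

lemma hausdorff_premeasure_le_finite_cover:
  fixes A :: "'a::metric_space set"
  assumes "finite \<U>" "A \<subseteq> \<Union>\<U>" "\<And>U. U \<in> \<U> \<Longrightarrow> bounded U" "\<And>U. U \<in> \<U> \<Longrightarrow> diameter U \<le> \<epsilon>"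
    and "0 < s" "0 \<le> \<epsilon>" "\<epsilon> \<le> \<delta>"
  shows "hausdorff_premeasure s \<delta> A \<le> ennreal (real (card \<U>) * \<epsilon> powr s)"
proof -
  obtain h where h: "bij_betw h {0..<card \<U>} \<U>"
    using ex_bij_betw_nat_finite[OF assms(1)] by blast
  \<comment> \<open>Hausdorff premeasure asks for a sequence of sets. The finite family is padded
    with empty sets, which have diameter 0 and contribute 0 to the sum.\<close>
  define U where "U i = (if i < card \<U> then h i else {})" for i
  have in\<U>: "h i \<in> \<U>" if "i < card \<U>" for i
    using bij_betwE[OF h] that by auto
  have cover: "A \<subseteq> (\<Union>i. U i)"
  proof
    fix x assume "x \<in> A"
    then obtain V where V: "V \<in> \<U>" "x \<in> V" using assms(2) by blast
    then obtain i where "i < card \<U>" "h i = V"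
      using bij_betw_imp_surj_on[OF h] by (metis atLeastLessThan_iff imageE)
    then show "x \<in> (\<Union>i. U i)" using V by (auto simp: U_def intro!: exI[of _ i])
  qed
  have small: "bounded (U i) \<and> diameter (U i) \<le> \<delta>" for i
    using assms in\<U>[of i] by (auto simp: U_def intro: order_trans)
  have "hausdorff_premeasure s \<delta> A \<le> (\<Sum>i. diam_power s (U i))"
    unfolding hausdorff_premeasure_def using cover small by (intro INF_lower) auto
  also have "\<dots> = (\<Sum>i<card \<U>. diam_power s (U i))"
    by (intro suminf_finite) (auto simp: U_def diam_power_def)
  also have "\<dots> \<le> (\<Sum>i<card \<U>. ennreal (\<epsilon> powr s))"
  proof (intro sum_mono)
    fix i assume "i \<in> {..<card \<U>}"
    then have "h i \<in> \<U>" "U i = h i" using in\<U> by (auto simp: U_def)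
    \<comment> \<open>Since \<open>0 < s\<close>, the convention for exponent 0 does not arise, and
      \<open>powr\<close> is monotone in its base.\<close>
    then show "diam_power s (U i) \<le> ennreal (\<epsilon> powr s)"
      using assms
      by (auto simp: diam_power_def intro!: ennreal_leI powr_mono2 diameter_ge_0)
  qed
  also have "\<dots> = ennreal (real (card \<U>) * \<epsilon> powr s)"
    by (simp add: ennreal_mult ennreal_of_nat_eq_real_of_nat)
  finally show ?thesis .
qed

text \<open>The Euclidean norm is at most the sum of the coordinate distances, each at most
  \<open>1 / m\<close>. The crude factor \<open>CARD('n)\<close> is independent of \<open>m\<close>,
  so it does not affect the limit.\<close>

lemma dist_face_cell_le:
  fixes x y :: "real ^ 'n"
  assumes "x \<in> face_cell m K c g" "y \<in> face_cell m K c g"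
  shows "dist x y \<le> real CARD('n) / real m"
proof -
  \<comment> \<open>Off \<open>K\<close> the difference is 0. For \<open>m = 0\<close> division by
    zero gives 0, so the cell is a single point and the bound still holds.\<close>
  have "\<bar>x $ i - y $ i\<bar> \<le> 1 / real m" for i
    using assms unfolding face_cell_def
    by (cases "i \<in> K") (auto simp: add_divide_distrib abs_le_iff split: if_splits dest!: spec[of _ i])
  then have "(\<Sum>i\<in>UNIV. \<bar>(x - y) $ i\<bar>) \<le> (\<Sum>i\<in>(UNIV::'n set). 1 / real m)"
    by (intro sum_mono) simp
  then show ?thesis
    using norm_le_l1_cart[of "x - y"] by (simp add: dist_norm)
qed

lemma bounded_face_cell: "bounded (face_cell m K c g)"
  unfolding bounded_two_points using dist_face_cell_le by blast

lemma diameter_face_cell_le: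
  "diameter (face_cell m K (c :: real ^ 'n) g) \<le> real CARD('n) / real m"
  using dist_face_cell_le by (intro diameter_le) (auto simp: dist_norm)

lemma unit_interval_subdivision:
  fixes x :: real
  assumes "0 < m" "0 \<le> x" "x \<le> 1"
  obtains j :: nat where "j < m" "real j / real m \<le> x" "x \<le> (real j + 1) / real m"
proof (cases "x = 1")
  case True
  \<comment> \<open>At \<open>x = 1\<close> the floor of \<open>x * m\<close> would be
    \<open>m\<close>, which is out of range; the last interval contains 1 as its right end.\<close>
  then show ?thesis using assms by (intro that[of "m - 1"]) (auto simp: field_simps of_nat_diff)
next
  case False
  let ?j = "nat \<lfloor>x * real m\<rfloor>"
  have pos: "0 \<le> x * real m" using assms by simp
  then have j: "real ?j \<le> x * real m" "x * real m < real ?j + 1" by linarith+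
  have "x * real m < real m" using False assms by simp
  with j(1) have "?j < m" by linarith
  then show ?thesis using j assms by (intro that[of ?j]) (auto simp: field_simps)
qed

lemma face_cube_subset_cells:
  assumes "0 < m"
  shows "face_cube K c \<subseteq> (\<Union>g \<in> K \<rightarrow>\<^sub>E {..<m}. face_cell m K c g)"
proof
  fix x assume x: "x \<in> face_cube K c"
  have "\<exists>j<m. real j / real m \<le> x $ i \<and> x $ i \<le> (real j + 1) / real m" if "i \<in> K" for i
  proof -
    have "0 \<le> x $ i" "x $ i \<le> 1" using x that by (auto simp: face_cube_def)
    then show ?thesis using unit_interval_subdivision[OF assms] by blast
  qed
  then obtain g where g: "\<And>i. i \<in> K \<Longrightarrow>
      g i < m \<and> real (g i) / real m \<le> x $ i \<and> x $ i \<le> (real (g i) + 1) / real m"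
    by metis
  \<comment> \<open>Restriction makes the index function extensional, so that the cells are indexed
    by a set of exactly \<open>m ^ card K\<close> functions.\<close>
  have "restrict g K \<in> K \<rightarrow>\<^sub>E {..<m}" using g by auto
  moreover have "x \<in> face_cell m K c (restrict g K)"
    using g x by (auto simp: face_cell_def face_cube_def)
  ultimately show "x \<in> (\<Union>g \<in> K \<rightarrow>\<^sub>E {..<m}. face_cell m K c g)" by blast
qed

text \<open>At most \<open>card S * m ^ d\<close> cells of diameter at most \<open>N / m\<close>
  cover \<open>A\<close>, so their total is at most
  \<open>card S * N powr s * m powr (d - s)\<close>. The exponent is negative, hence this tends to 0
  as \<open>m\<close> grows.\<close>

lemma hausdorff_measure_finite_union_cubes:
  fixes A :: "(real ^ 'n) set" and K :: "'b \<Rightarrow> 'n set"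
  assumes fin: "finite S" and cover: "A \<subseteq> (\<Union>p\<in>S. face_cube (K p) (c p))"
    and card: "\<And>p. p \<in> S \<Longrightarrow> card (K p) = d" and s: "real d < s"
  shows "hausdorff_measure s A = 0"
proof -
  define N where "N = real CARD('n)"
  have N: "0 < N" by (simp add: N_def)
  have bound: "hausdorff_premeasure s \<delta> A \<le> ennreal (real (card S) * N powr s * real m powr (real d - s))"
    if m: "0 < m" "N / real m \<le> \<delta>" for m \<delta>
  proof -
    define I where "I = (SIGMA p:S. K p \<rightarrow>\<^sub>E {..<m})"
    define \<U> where "\<U> = (\<lambda>(p, g). face_cell m (K p) (c p) g) ` I"
    have finI: "finite I" using fin by (auto simp: I_def intro!: finite_PiE)
    have "card I = (\<Sum>p\<in>S. card (K p \<rightarrow>\<^sub>E {..<m}))"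
      unfolding I_def using fin by (intro card_SigmaI) (auto intro!: finite_PiE)
    also have "\<dots> = card S * m ^ d" by (simp add: card card_PiE)
    finally have "card \<U> \<le> card S * m ^ d"
      unfolding \<U>_def using card_image_le[OF finI] by metis
    then have card\<U>: "real (card \<U>) \<le> real (card S) * real m ^ d"
      by (metis of_nat_le_iff of_nat_mult of_nat_power)
    have sub: "A \<subseteq> \<Union>\<U>"
    proof
      fix x assume "x \<in> A"
      then obtain p where "p \<in> S" "x \<in> face_cube (K p) (c p)" using cover by blast
      moreover from this obtain g where "g \<in> K p \<rightarrow>\<^sub>E {..<m}" "x \<in> face_cell m (K p) (c p) g"
        using face_cube_subset_cells[OF m(1)] by blast
      ultimately show "x \<in> \<Union>\<U>" by (auto simp: \<U>_def I_def)
    qed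
    have "hausdorff_premeasure s \<delta> A \<le> ennreal (real (card \<U>) * (N / real m) powr s)"
    proof (rule hausdorff_premeasure_le_finite_cover[OF _ sub])
      show "finite \<U>" using finI by (simp add: \<U>_def)
      show "bounded U" if "U \<in> \<U>" for U using that bounded_face_cell by (auto simp: \<U>_def)
      show "diameter U \<le> N / real m" if "U \<in> \<U>" for U
        using that diameter_face_cell_le by (auto simp: \<U>_def N_def)
    qed (use m s N in auto)
    also have "real (card \<U>) * (N / real m) powr s
        \<le> real (card S) * real m ^ d * (N / real m) powr s"
      using card\<U> by (rule mult_right_mono) simp
    also have "\<dots> = real (card S) * N powr s * real m powr (real d - s)"
      using m N by (simp add: powr_divide powr_diff powr_realpow)
    finally show ?thesis by (simp add: ennreal_leI)
  qed
  have "hausdorff_premeasure s \<delta> A = 0" if "0 < \<delta>" for \<delta>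
  proof -
    have "(\<lambda>m. real (card S) * N powr s * real m powr (real d - s)) \<longlonglongrightarrow> 0"
      using s by (intro tendsto_mult_right_zero tendsto_neg_powr filterlim_real_sequentially) simp
    then have lim: "(\<lambda>m. ennreal (real (card S) * N powr s * real m powr (real d - s))) \<longlonglongrightarrow> 0"
      by (metis ennreal_0 tendsto_ennrealI)
    have "(\<lambda>m. N / real m) \<longlonglongrightarrow> 0" by (rule lim_const_over_n)
    \<comment> \<open>For fixed \<open>\<delta>\<close> the cover is admissible only once its cells
      are small enough, so the bound holds for all large \<open>m\<close>.\<close>
    then have "\<forall>\<^sub>F m in sequentially. N / real m < \<delta>" using that by (rule order_tendstoD)
    then have "\<forall>\<^sub>F m in sequentially.
        hausdorff_premeasure s \<delta> A \<le> ennreal (real (card S) * N powr s * real m powr (real d - s))"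
      using eventually_gt_at_top[of 0] by eventually_elim (auto intro!: bound)
    then have "hausdorff_premeasure s \<delta> A \<le> 0"
      by (intro tendsto_lowerbound[OF lim]) auto
    then show ?thesis by simp
  qed
  then show ?thesis by (simp add: hausdorff_measure_def)
qed

text \<open>The measure at exponent \<open>d\<close> itself may be positive, so the infimum is
  approached through the exponents \<open>d + e\<close> with \<open>e > 0\<close>.\<close>

lemma hausdorff_dim_le_of_null:
  assumes "0 \<le> d" "\<And>s. d < s \<Longrightarrow> hausdorff_measure s A = 0"
  shows "hausdorff_dim A \<le> ennreal d"
proof (rule ennreal_le_epsilon)
  fix e :: real assume e: "0 < e"
  have "hausdorff_dim A \<le> ennreal (d + e)"
    unfolding hausdorff_dim_def using assms e by (intro Inf_lower) (auto intro!: exI[of _ "d + e"])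
  then show "hausdorff_dim A \<le> ennreal d + ennreal e" using assms(1) e by simp
qed

lemma nkt_set_subset_face_cubes:
  assumes "nkt_set k t A" "a \<in> A"
  shows "A \<subseteq> (\<Union>(I, J) \<in> {(I, J). I \<subseteq> J \<and> card I = t \<and> card J = k}.
                face_cube (J - I) (\<chi> i. if i \<in> I then a $ i else 0))"
proof
  fix x assume x: "x \<in> A"
  define J where "J = {i. x $ i > 0}"
  obtain I where I: "card I = t" "\<And>i. i \<in> I \<Longrightarrow> x $ i = a $ i \<and> x $ i > 0"
    using assms x unfolding nkt_set_def by blast
  have "card J = k" using assms(1) x by (simp add: nkt_set_def J_def)
  moreover have "I \<subseteq> J" using I by (auto simp: J_def)
  moreover have "x \<in> face_cube (J - I) (\<chi> i. if i \<in> I then a $ i else 0)"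
  proof -
    have "\<And>i. 0 \<le> x $ i \<and> x $ i \<le> 1" using assms(1) x by (auto simp: nkt_set_def)
    moreover have "x $ i = 0" if "i \<notin> J" for i
      using that calculation[of i] by (simp add: J_def)
    ultimately show ?thesis using I by (auto simp: face_cube_def)
  qed
  ultimately show "x \<in> (\<Union>(I, J) \<in> {(I, J). I \<subseteq> J \<and> card I = t \<and> card J = k}.
      face_cube (J - I) (\<chi> i. if i \<in> I then a $ i else 0))"
    using I(1) by blast
qed

theorem theorem1p9:
  fixes n k t :: nat and A :: "(real ^ 'n) set"
  assumes "CARD('n) = n"
    and "n \<ge> k" and "k > t" and "t > 0"
    and "nkt_set k t A"
  shows "hausdorff_dim A \<le> of_nat (k - t)"
proof -
  define S :: "('n set \<times> 'n set) set" where "S = {(I, J). I \<subseteq> J \<and> card I = t \<and> card J = k}"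
  \<comment> \<open>Any element of a nonempty \<open>A\<close> serves as \<open>a\<close>; for empty
    \<open>A\<close> the inclusion holds for every \<open>a\<close>.\<close>
  obtain a where "A \<subseteq> (\<Union>(I, J) \<in> S. face_cube (J - I) (\<chi> i. if i \<in> I then a $ i else 0))"
    using nkt_set_subset_face_cubes[OF assms(5)] unfolding S_def by (cases "A = {}") blast+
  then have cover: "A \<subseteq> (\<Union>p\<in>S. face_cube (snd p - fst p) (\<chi> i. if i \<in> fst p then a $ i else 0))"
    by (simp add: case_prod_unfold)
  have "card (snd p - fst p) = k - t" if "p \<in> S" for p
    using that by (auto simp: S_def card_Diff_subset)
  then have "hausdorff_measure s A = 0" if "real (k - t) < s" for s
    using that by (intro hausdorff_measure_finite_union_cubes[OF _ cover]) auto
  then show ?thesis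
    using hausdorff_dim_le_of_null[of "real (k - t)" A]
    by (simp add: ennreal_of_nat_eq_real_of_nat)
qed

end
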